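(* Let $\lambda>0$ and let $f=h+\overline{g}\in\Omega_{\mathcal{H}}^0(\lambda)$ with $h(z)=z+\sum_{n=2}^\infty a_nz^n$ and $g(z)=\sum_{n=2}^\infty b_nz^n$. Then for every integer $n\ge2$, $$|a_n|\le\frac{\lambda}{n-1}\quad\text{and}\quad|b_n|\le\frac{\lambda}{n-1}.$$ Both bounds are sharp: for every $n\ge2$ there is a function in $\Omega_{\mathcal{H}}^0(\lambda)$ with $|a_n|=\frac{\lambda}{n-1}$, and a function in $\Omega_{\mathcal{H}}^0(\lambda)$ with $|b_n|=\frac{\lambda}{n-1}$.
   Context: $\mathbb{D}=\{z\in\mathbb{C}:|z|<1\}$. $\mathcal{H}^0$ is the class of complex-valued harmonic functions $f=h+\overline{g}$ on $\mathbb{D}$, where $h,g$ are analytic on $\mathbb{D}$ with $h(z)=z+\sum_{n\ge2}a_nz^n$ and $g(z)=\sum_{n\ge2}b_nz^n$. For $\lambda>0$, $\Omega_{\mathcal{H}}^0(\lambda)$ is the set of $f=h+\overline{g}\in\mathcal{H}^0$ such that $|h(z)-zh'(z)|<\lambda-|g(z)-zg'(z)|$ for all $z\in\mathbb{D}$. *)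

theory Defs
  imports "HOL-Complex_Analysis.Complex_Analysis"
begin

abbreviation unit_disc :: "complex set" where
  "unit_disc \<equiv> ball 0 1"

text \<open>
  The decomposition f = h + cnj g on the unit disc, with
  h(z) = z + a(2) z^2 + a(3) z^3 + ... and g(z) = b(2) z^2 + b(3) z^3 + ....
  Only the values of f, h, g on the disc and the coefficients with index at least 2 matter;
  the values a 0, a 1, b 0, b 1 are unconstrained and unused.
\<close>

definition canonical_rep ::
  "(complex \<Rightarrow> complex) \<Rightarrow> (complex \<Rightarrow> complex) \<Rightarrow> (complex \<Rightarrow> complex) \<Rightarrow>
   (nat \<Rightarrow> complex) \<Rightarrow> (nat \<Rightarrow> complex) \<Rightarrow> bool" where
  "canonical_rep f h g a b \<longleftrightarrow>
     h analytic_on unit_disc \<and> g analytic_on unit_disc \<and>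
     (\<forall>z\<in>unit_disc. f z = h z + cnj (g z)) \<and>
     (\<forall>z\<in>unit_disc. (\<lambda>k. a (k + 2) * z ^ (k + 2)) sums (h z - z)) \<and>
     (\<forall>z\<in>unit_disc. (\<lambda>k. b (k + 2) * z ^ (k + 2)) sums g z)"

text \<open>
  Harmonicity is not a separate requirement: every function of the form h + cnj g with
  h and g analytic is harmonic.
\<close>

definition harmonic_class :: "(complex \<Rightarrow> complex) set" where
  "harmonic_class = {f. \<exists>h g a b. canonical_rep f h g a b}"

definition Omega_H0 :: "real \<Rightarrow> (complex \<Rightarrow> complex) set" where
  "Omega_H0 l = {f \<in> harmonic_class. \<exists>h g a b. canonical_rep f h g a b \<and>
     (\<forall>z\<in>unit_disc. cmod (h z - z * deriv h z) < l - cmod (g z - z * deriv g z))}"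

end

theory Submission
  imports Defs
begin

text \<open>
  The operator f - z f' multiplies the n-th Taylor coefficient by 1 - n, and it is bounded by
  \<open>l\<close> on the disc for both h and g, so Cauchy's inequality on circles of radius tending to 1
  gives the bounds.  Membership in the class only provides some decomposition h + cnj g; it is
  the only one, since the difference of two is a holomorphic function whose conjugate
  is holomorphic as well.  The extremal functions are z + c z^n and z + cnj (c z^n) with
  c = \<open>l\<close> / (n - 1).
\<close>

lemma has_fps_expansion_sums_ball:
  fixes f :: "complex \<Rightarrow> complex"
  assumes "0 < r" and "\<And>z. z \<in> ball 0 r \<Longrightarrow> (\<lambda>n. c n * z ^ n) sums f z"
  shows "f has_fps_expansion Abs_fps c"
proof (rule has_fps_expansionI)
  have "eventually (\<lambda>z. z \<in> ball 0 r) (nhds (0::complex))"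
    using assms(1) by (intro eventually_nhds_in_open) auto
  then show "eventually (\<lambda>z. (\<lambda>n. fps_nth (Abs_fps c) n * z ^ n) sums f z) (nhds 0)"
    by eventually_elim (simp add: assms(2))
qed

text \<open>\<open>canonical_rep\<close> ties \<open>a\<close> to \<open>h\<close> only from index 2
  on, so the normalization of \<open>h\<close> at the origin is written into the series as the
  explicit coefficients 0 and 1.\<close>

lemma canonical_rep_fps_h:
  assumes "canonical_rep f h g a b"
  shows "h has_fps_expansion Abs_fps (\<lambda>n. if n = 0 then 0 else if n = 1 then 1 else a n)"
proof (rule has_fps_expansion_sums_ball[of 1])
  fix z :: complex assume "z \<in> ball 0 1"
  with assms have "(\<lambda>k. a (k + 2) * z ^ (k + 2)) sums (h z - z)"
    by (simp add: canonical_rep_def)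
  then show "(\<lambda>n. (if n = 0 then 0 else if n = 1 then 1 else a n) * z ^ n) sums h z"
    \<comment> \<open>The two terms split off by the shift add up to \<open>z\<close>, which turns
      the sum \<open>h z - z\<close> into \<open>h z\<close>.\<close>
    using sums_iff_shift[of "\<lambda>n. (if n = 0 then 0 else if n = 1 then 1 else a n) * z ^ n" 2] by (simp add: numeral_2_eq_2)
qed simp

lemma canonical_rep_fps_g:
  assumes "canonical_rep f h g a b"
  shows "g has_fps_expansion Abs_fps (\<lambda>n. if n < 2 then 0 else b n)"
proof (rule has_fps_expansion_sums_ball[of 1])
  fix z :: complex assume "z \<in> ball 0 1"
  with assms have "(\<lambda>k. b (k + 2) * z ^ (k + 2)) sums g z"
    by (simp add: canonical_rep_def)
  then show "(\<lambda>n. (if n < 2 then 0 else b n) * z ^ n) sums g z"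
    using sums_iff_shift[of "\<lambda>n. (if n < 2 then 0 else b n) * z ^ n" 2] by (simp add: numeral_2_eq_2)
qed simp

lemma cmod_fps_nth_le:
  assumes "f holomorphic_on ball 0 1" and "\<And>z. z \<in> ball 0 1 \<Longrightarrow> cmod (f z) \<le> B"
    and "f has_fps_expansion F"
  shows "cmod (fps_nth F n) \<le> B"
proof -
  have bd: "cmod (fps_nth F n) * r ^ n \<le> B" if r: "0 < r" "r < 1" for r :: real
  proof -
    have hol: "f holomorphic_on cball 0 r"
      using assms(1) by (rule holomorphic_on_subset) (use r in auto)
    have "cmod ((deriv ^^ n) f 0) \<le> fact n * B / r ^ n"
    proof (rule Cauchy_inequality)
      show "f holomorphic_on ball 0 r"
        using hol by (rule holomorphic_on_subset) auto
      show "continuous_on (cball 0 r) f"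
        using hol by (rule holomorphic_on_imp_continuous_on)
      show "cmod (f x) \<le> B" if "cmod (0 - x) = r" for x
        using that r by (intro assms(2)) simp
    qed (use r in auto)
    moreover have "(deriv ^^ n) f 0 = fact n * fps_nth F n"
      using fps_nth_fps_expansion[OF assms(3), of n] by simp
    ultimately show ?thesis using r by (simp add: norm_mult field_simps)
  qed
  \<comment> \<open>The bound on \<open>f\<close> is known only inside the open disc, so radius 1 is
    reached as a limit from the left.\<close>
  have "((\<lambda>r. cmod (fps_nth F n) * r ^ n) \<longlongrightarrow> cmod (fps_nth F n) * 1 ^ n) (at_left (1::real))"
    by (intro tendsto_intros)
  moreover have "eventually (\<lambda>r. cmod (fps_nth F n) * r ^ n \<le> B) (at_left (1::real))"
    using eventually_at_left_real[OF zero_less_one]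
    by eventually_elim (use bd in auto)
  ultimately have "cmod (fps_nth F n) * 1 ^ n \<le> B"
    by (rule tendsto_upperbound) simp
  then show ?thesis by simp
qed

text \<open>The Euler operator \<open>fps_X * fps_deriv\<close> scales the coefficient of index n by
  n. Hence \<open>f z - z * deriv f z\<close> has coefficient (1 - n) times that of
  \<open>f\<close>, and n \<ge> 2 makes the division by n - 1 legitimate.\<close>

lemma cmod_fps_nth_le_of_euler_defect:
  assumes hol: "f holomorphic_on ball 0 1"
    and bound: "\<And>z. z \<in> ball 0 1 \<Longrightarrow> cmod (f z - z * deriv f z) \<le> B"
    and F: "f has_fps_expansion F" and n: "n \<ge> 2"
  shows "cmod (fps_nth F n) \<le> B / (real n - 1)"
proof -
  have "(\<lambda>z. f z - z * deriv f z) has_fps_expansion F - fps_X * fps_deriv F"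
    by (intro fps_expansion_intros F)
  moreover have "(\<lambda>z. f z - z * deriv f z) holomorphic_on ball 0 1"
    by (intro holomorphic_intros hol) auto
  ultimately have "cmod (fps_nth (F - fps_X * fps_deriv F) n) \<le> B"
    using bound by (intro cmod_fps_nth_le)
  moreover have "fps_nth (F - fps_X * fps_deriv F) n = - (of_real (real n - 1) * fps_nth F n)"
    using n by (simp add: algebra_simps)
  ultimately have "(real n - 1) * cmod (fps_nth F n) \<le> B"
    using n by (simp add: norm_mult del: of_real_diff)
  then show ?thesis using n by (simp add: field_simps)
qed

text \<open>The real differential of \<open>cnj (f z)\<close> is conjugate-linear because
  \<open>f\<close> is holomorphic, and complex-linear by the second assumption. Only the zero map is
  both.\<close>

lemma holomorphic_cnj_holomorphic_constant:
  assumes "open S" "connected S" "f holomorphic_on S" "(\<lambda>z. cnj (f z)) holomorphic_on S"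
    and "x \<in> S" "y \<in> S"
  shows "f x = f y"
proof -
  have "(f has_field_derivative 0) (at z)" if zS: "z \<in> S" for z
  proof -
    obtain c d where c: "(f has_field_derivative c) (at z)"
      and d: "((\<lambda>z. cnj (f z)) has_field_derivative d) (at z)"
      using holomorphic_on_imp_differentiable_at[OF assms(3,1) zS]
        holomorphic_on_imp_differentiable_at[OF assms(4,1) zS]
      unfolding field_differentiable_def by blast
    have "((\<lambda>z. cnj (f z)) has_derivative (\<lambda>v. cnj (c * v))) (at z)"
      using has_derivative_cnj c unfolding has_field_derivative_def by blast
    with d have "(*) d = (\<lambda>v. cnj (c * v))"
      unfolding has_field_derivative_def by (rule has_derivative_unique)
    \<comment> \<open>The values at 1 and \<i> give d = cnj c and d = - cnj c.\<close>
    from fun_cong[OF this, of 1] fun_cong[OF this, of \<i>] have "c = 0" by simp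
    with c show ?thesis by simp
  qed
  then show ?thesis
    using has_field_derivative_0_imp_constant_on[of S f] assms
    unfolding constant_on_def by metis
qed

lemma canonical_rep_at_0:
  assumes "canonical_rep f h g a b"
  shows "h 0 = 0" "g 0 = 0"
  using has_fps_expansion_imp_0_eq_fps_nth_0[OF canonical_rep_fps_h[OF assms]]
    has_fps_expansion_imp_0_eq_fps_nth_0[OF canonical_rep_fps_g[OF assms]] by auto

text \<open>Equating the two decompositions shows that the conjugate of \<open>h - h'\<close> is the
  holomorphic function \<open>g' - g\<close>. So \<open>h - h'\<close> is constant, and the constant
  vanishes because \<open>h\<close> and \<open>h'\<close> are both 0 at the origin.\<close>

lemma canonical_rep_unique:
  assumes r1: "canonical_rep f h g a b" and r2: "canonical_rep f h' g' a' b'" and z: "z \<in> unit_disc"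
  shows "h z = h' z" "g z = g' z"
proof -
  have hol: "h holomorphic_on unit_disc" "g holomorphic_on unit_disc"
    "h' holomorphic_on unit_disc" "g' holomorphic_on unit_disc"
    using r1 r2 by (auto simp: canonical_rep_def intro: analytic_imp_holomorphic)
  have eq: "cnj (h w - h' w) = g' w - g w" if "w \<in> unit_disc" for w
  proof -
    have "h w + cnj (g w) = h' w + cnj (g' w)"
      using r1 r2 that unfolding canonical_rep_def by metis
    then have "h w - h' w = cnj (g' w - g w)" by (simp add: algebra_simps)
    then show ?thesis by simp
  qed
  have "(\<lambda>w. cnj (h w - h' w)) holomorphic_on unit_disc \<longleftrightarrow> (\<lambda>w. g' w - g w) holomorphic_on unit_disc"
    by (rule holomorphic_cong) (use eq in auto)
  then have "h z - h' z = h 0 - h' 0"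
    using z hol
    by (intro holomorphic_cnj_holomorphic_constant[of unit_disc "\<lambda>w. h w - h' w"])
      (auto intro: holomorphic_intros)
  then show "h z = h' z"
    using canonical_rep_at_0[OF r1] canonical_rep_at_0[OF r2] by simp
  with eq[OF z] show "g z = g' z" by simp
qed

lemma canonical_rep_coeff_unique:
  assumes r1: "canonical_rep f h g a b" and r2: "canonical_rep f h' g' a' b'" and n: "n \<ge> 2"
  shows "a n = a' n" "b n = b' n"
proof -
  have nh: "eventually (\<lambda>z. z \<in> unit_disc) (nhds 0)"
    by (intro eventually_nhds_in_open) auto
  have "eventually (\<lambda>z. h z = h' z) (nhds 0)" "eventually (\<lambda>z. g z = g' z) (nhds 0)"
    using nh canonical_rep_unique[OF r1 r2] by (auto elim: eventually_mono)
  then have "h has_fps_expansion Abs_fps (\<lambda>n. if n = 0 then 0 else if n = 1 then 1 else a' n)"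
    "g has_fps_expansion Abs_fps (\<lambda>n. if n < 2 then 0 else b' n)"
    using canonical_rep_fps_h[OF r2] canonical_rep_fps_g[OF r2]
    by (simp_all cong: has_fps_expansion_cong)
  from fps_expansion_unique_complex[OF this(1) canonical_rep_fps_h[OF r1]]
    fps_expansion_unique_complex[OF this(2) canonical_rep_fps_g[OF r1]]
  show "a n = a' n" "b n = b' n"
    using n by (auto simp: fps_eq_iff split: if_splits dest!: spec[of _ n])
qed

text \<open>The defining inequality is available only for some decomposition \<open>h'\<close>,
  \<open>g'\<close>. The bounds are proved for its coefficients and carried over to \<open>a\<close>
  and \<open>b\<close> by uniqueness.\<close>

lemma Omega_H0_coeff_bound:
  assumes f: "f \<in> Omega_H0 l" and rep: "canonical_rep f h g a b" and n: "n \<ge> 2"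
  shows "cmod (a n) \<le> l / (real n - 1)" "cmod (b n) \<le> l / (real n - 1)"
proof -
  obtain h' g' a' b' where rep': "canonical_rep f h' g' a' b'"
    and lt: "\<And>z. z \<in> unit_disc \<Longrightarrow>
      cmod (h' z - z * deriv h' z) < l - cmod (g' z - z * deriv g' z)"
    using f by (auto simp: Omega_H0_def)
  have hol: "h' holomorphic_on unit_disc" "g' holomorphic_on unit_disc"
    using rep' by (auto simp: canonical_rep_def intro: analytic_imp_holomorphic)
  have bd: "cmod (h' z - z * deriv h' z) \<le> l" "cmod (g' z - z * deriv g' z) \<le> l"
    if "z \<in> unit_disc" for z
    using lt[OF that] norm_ge_zero[of "h' z - z * deriv h' z"]
      norm_ge_zero[of "g' z - z * deriv g' z"] by linarith+
  show "cmod (a n) \<le> l / (real n - 1)" "cmod (b n) \<le> l / (real n - 1)"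
    using cmod_fps_nth_le_of_euler_defect[OF hol(1) bd(1) canonical_rep_fps_h[OF rep'] n]
      cmod_fps_nth_le_of_euler_defect[OF hol(2) bd(2) canonical_rep_fps_g[OF rep'] n]
      canonical_rep_coeff_unique[OF rep rep' n] n
    by auto
qed

text \<open>Both extremal functions come from one family: the condition on \<alpha> and \<beta>
  makes the two defects add up to exactly l |z|^n, which is below l in the open disc.\<close>

lemma monomial_perturbation:
  fixes \<alpha> \<beta> :: complex
  assumes l: "l > 0" and n: "n \<ge> 2" and ab: "cmod \<alpha> + cmod \<beta> = l / (real n - 1)"
  defines "h \<equiv> \<lambda>z. z + \<alpha> * z ^ n" and "g \<equiv> \<lambda>z. \<beta> * z ^ n"
  defines "f \<equiv> \<lambda>z. h z + cnj (g z)"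
    and "a \<equiv> \<lambda>k. if k = n then \<alpha> else 0" and "b \<equiv> \<lambda>k. if k = n then \<beta> else 0"
  shows "f \<in> Omega_H0 l" "canonical_rep f h g a b"
proof -
  have single: "(\<lambda>k. (if k + 2 = n then c else 0) * z ^ (k + 2)) sums (c * z ^ n)" for c z :: complex
  proof -
    \<comment> \<open>The series in \<open>canonical_rep\<close> starts at exponent 2, so exponent n
      sits at index m = n - 2.\<close>
    obtain m where m: "n = m + 2" using n le_Suc_ex by (metis add.commute)
    have "(\<lambda>k. (if k + 2 = n then c else 0) * z ^ (k + 2)) = (\<lambda>k. if k = m then c * z ^ (k + 2) else 0)"
      by (auto simp: m)
    then show ?thesis
      using sums_single[of m "\<lambda>k. c * z ^ (k + 2)"] unfolding m by simp
  qed
  show rep: "canonical_rep f h g a b"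
    unfolding canonical_rep_def f_def h_def g_def a_def b_def
    using single by (auto intro!: analytic_intros)
  have defect: "cmod (\<gamma> * z ^ n - z * (\<gamma> * (of_nat n * z ^ (n - 1)))) = (real n - 1) * cmod \<gamma> * cmod z ^ n"
    for \<gamma> z :: complex
  proof -
    have "\<gamma> * z ^ n - z * (\<gamma> * (of_nat n * z ^ (n - 1))) = - (of_real (real n - 1) * \<gamma> * z ^ n)"
      using n by (cases n) (auto simp: algebra_simps)
    then show ?thesis using n by (simp add: norm_mult norm_power del: of_real_diff)
  qed
  have "cmod (h z - z * deriv h z) < l - cmod (g z - z * deriv g z)" if z: "z \<in> unit_disc" for z
  proof -
    have "(h has_field_derivative 1 + \<alpha> * (of_nat n * z ^ (n - 1))) (at z)"
      "(g has_field_derivative \<beta> * (of_nat n * z ^ (n - 1))) (at z)"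
      unfolding h_def g_def by (auto intro!: derivative_eq_intros)
    \<comment> \<open>The linear term of \<open>h\<close> cancels, since z - z * 1 = 0; only the
      monomials contribute.\<close>
    then have "h z - z * deriv h z = \<alpha> * z ^ n - z * (\<alpha> * (of_nat n * z ^ (n - 1)))"
      "g z - z * deriv g z = \<beta> * z ^ n - z * (\<beta> * (of_nat n * z ^ (n - 1)))"
      by (simp_all add: DERIV_imp_deriv h_def g_def algebra_simps)
    then have "cmod (h z - z * deriv h z) + cmod (g z - z * deriv g z)
      = (real n - 1) * (cmod \<alpha> + cmod \<beta>) * cmod z ^ n"
      by (simp only: defect distrib_left distrib_right)
    also have "\<dots> = l * cmod z ^ n" using ab n by simp
    \<comment> \<open>Strictness needs a positive exponent, which n \<ge> 2 supplies.\<close>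
    also have "\<dots> < l" using l z n by (simp add: power_less_one_iff)
    finally show ?thesis by simp
  qed
  with rep show "f \<in> Omega_H0 l"
    unfolding Omega_H0_def harmonic_class_def by blast
qed

theorem theorem2p2:
  fixes l :: real
  assumes "l > 0"
  shows "(\<forall>f\<in>Omega_H0 l. \<forall>h g a b. canonical_rep f h g a b \<longrightarrow>
            (\<forall>n::nat. n \<ge> 2 \<longrightarrow>
               cmod (a n) \<le> l / (real n - 1) \<and> cmod (b n) \<le> l / (real n - 1)))
       \<and> (\<forall>n::nat. n \<ge> 2 \<longrightarrow>
            (\<exists>f\<in>Omega_H0 l. \<exists>h g a b. canonical_rep f h g a b \<and> cmod (a n) = l / (real n - 1)) \<and>
            (\<exists>f\<in>Omega_H0 l. \<exists>h g a b. canonical_rep f h g a b \<and> cmod (b n) = l / (real n - 1)))"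
proof (intro conjI allI impI ballI)
  fix n :: nat assume n: "n \<ge> 2"
  define \<gamma> :: complex where "\<gamma> = of_real (l / (real n - 1))"
  have \<gamma>: "cmod \<gamma> = l / (real n - 1)"
    using assms n unfolding \<gamma>_def norm_of_real by simp
  \<comment> \<open>The whole weight goes to \<alpha> for the sharpness of the bound on
    \<open>a n\<close>, and to \<beta> for that on \<open>b n\<close>.\<close>
  then have sum: "cmod \<gamma> + cmod 0 = l / (real n - 1)" "cmod 0 + cmod \<gamma> = l / (real n - 1)"
    by simp_all
  show "\<exists>f\<in>Omega_H0 l. \<exists>h g a b. canonical_rep f h g a b \<and> cmod (a n) = l / (real n - 1)"
    by (intro bexI exI conjI, rule monomial_perturbation(2)[OF assms n sum(1)],
        simp add: \<gamma>, rule monomial_perturbation(1)[OF assms n sum(1)])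
  show "\<exists>f\<in>Omega_H0 l. \<exists>h g a b. canonical_rep f h g a b \<and> cmod (b n) = l / (real n - 1)"
    by (intro bexI exI conjI, rule monomial_perturbation(2)[OF assms n sum(2)],
        simp add: \<gamma>, rule monomial_perturbation(1)[OF assms n sum(2)])
qed (use Omega_H0_coeff_bound in blast)+

end
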